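(* For the Broadwell model $$\partial_tf_++\partial_xf_+=\tfrac1\varepsilon(f_0^2-f_+f_-),\quad \partial_tf_0=-\tfrac1\varepsilon(f_0^2-f_+f_-),\quad \partial_tf_--\partial_xf_-=\tfrac1\varepsilon(f_0^2-f_+f_-),$$ put $f=(f_+,f_0,f_-)^T$, $\mathcal T(f)=(-\partial_xf_+,0,\partial_xf_-)^T$ with the $x$-derivative discretized by a positivity-preserving spatial discretization, and $\mathcal Q(f)=(f_0^2-f_+f_-,\,-(f_0^2-f_+f_-),\,f_0^2-f_+f_-)^T$. Then $\mathcal T$ and $\mathcal Q$ satisfy: (P1) $f\ge0$ implies $f+a\Delta t\,\mathcal T(f)\ge0$ for every constant $a$ with $0\le a\Delta t\le\mathcal C$, where $\mathcal C$ is the CFL constraint for positivity of the forward Euler step of the discretized transport operator; (P2) if $g\ge0$ and $f-b\mathcal Q(f)=g$ with a constant $b\ge0$, then $f\ge0$; (P3) if $g,h\ge0$ and $f+b\mathcal Q'(g)\mathcal Q(f)=h$ with a constant $b\ge0$, then $f\ge0$; (P4) if $h\ge0$ and $f+b\mathcal Q'(f)\mathcal Q(f)=h$ with a constant $b\ge0$, then $f\ge0$.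
   Context: $f_+,f_0,f_-$ are the mass densities of particles with speeds $1,0,-1$; $\varepsilon>0$ is the mean free path. $f\ge0$ means that all three components are (pointwise) nonnegative. $\mathcal Q'(g)f=\lim_{\delta\to0}\frac{\mathcal Q(g+\delta f)-\mathcal Q(g)}{\delta}$. A positivity-preserving spatial discretization $\mathcal T_{\Delta x}$ of $\mathcal T$ is one for which there is a maximal forward Euler step $\Delta t_{\mathrm{FE}}>0$ such that $f\ge0$ implies $f+s\,\mathcal T_{\Delta x}(f)\ge0$ for $0\le s\le\Delta t_{\mathrm{FE}}$; then $\mathcal C=\Delta t_{\mathrm{FE}}$. *)

theory Defs
  imports "HOL-Analysis.Analysis"
begin

text \<open>
  A state is a field \<open>f\<close> on a set of spatial points (the type \<open>'x\<close>, e.g. a grid), with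
  \<open>f x $ 1\<close>, \<open>f x $ 2\<close>, \<open>f x $ 3\<close> the densities of the particles of speed \<open>1\<close>, \<open>0\<close>, \<open>-1\<close>.
\<close>

type_synonym 'x state = "'x \<Rightarrow> real ^ 3"

definition nonneg :: "'x state \<Rightarrow> bool" where
  "nonneg f \<longleftrightarrow> (\<forall>x i. 0 \<le> f x $ i)"

text \<open>
  \<open>Dp\<close> and \<open>Dm\<close> stand for the \<open>x\<close>-derivative in the first and in the third equation.  They are
  separate arguments, since upwinding discretizes the two derivatives differently, and they need
  not be linear, since limiters are not.  The undiscretized operator is \<open>transport deriv deriv\<close>.
\<close>

definition transport ::
    "(('x \<Rightarrow> real) \<Rightarrow> 'x \<Rightarrow> real) \<Rightarrow> (('x \<Rightarrow> real) \<Rightarrow> 'x \<Rightarrow> real) \<Rightarrow> 'x state \<Rightarrow> 'x state" where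
  "transport Dp Dm f = (\<lambda>x. vector [- Dp (\<lambda>y. f y $ 1) x, 0, Dm (\<lambda>y. f y $ 3) x])"

definition collision :: "'x state \<Rightarrow> 'x state" where
  "collision f = (\<lambda>x.
     vector [(f x $ 2)\<^sup>2 - f x $ 1 * f x $ 3,
             - ((f x $ 2)\<^sup>2 - f x $ 1 * f x $ 3),
             (f x $ 2)\<^sup>2 - f x $ 1 * f x $ 3])"

text \<open>The directional derivative \<open>Q'(g)f\<close>, with the limit taken at each spatial point.\<close>

definition dir_deriv :: "('x state \<Rightarrow> 'x state) \<Rightarrow> 'x state \<Rightarrow> 'x state \<Rightarrow> 'x state" where
  "dir_deriv Q g f =
     (\<lambda>x. Lim (at 0) (\<lambda>\<delta>::real. (Q (\<lambda>y. g y + \<delta> *\<^sub>R f y) x - Q g x) /\<^sub>R \<delta>))"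

definition fe_positive :: "('x state \<Rightarrow> 'x state) \<Rightarrow> real \<Rightarrow> bool" where
  "fe_positive T \<tau> \<longleftrightarrow> \<tau> > 0 \<and>
     (\<forall>f s. nonneg f \<longrightarrow> 0 \<le> s \<longrightarrow> s \<le> \<tau> \<longrightarrow> nonneg (\<lambda>x. f x + s *\<^sub>R T f x))"

definition positivity_preserving :: "('x state \<Rightarrow> 'x state) \<Rightarrow> bool" where
  "positivity_preserving T \<longleftrightarrow>
     (\<exists>\<tau>. fe_positive T \<tau> \<and> (\<forall>\<sigma>. fe_positive T \<sigma> \<longrightarrow> \<sigma> \<le> \<tau>))"

definition cfl :: "('x state \<Rightarrow> 'x state) \<Rightarrow> real" where
  "cfl T = (GREATEST \<tau>. fe_positive T \<tau>)"

end

theory Submission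
  imports Defs
begin

text \<open>
  Every collision changes the state in the single direction \<open>(1,-1,1)\<close>, which conserves the
  mass \<open>m = f\<^sub>+ + 2 f\<^sub>0 + f\<^sub>-\<close>, and since the collision rate
  \<open>q(f) = f\<^sub>0\<^sup>2 - f\<^sub>+ f\<^sub>-\<close> loses its quadratic part along that direction, the implicit equation
  \<open>f - b Q(f) = g\<close> is linear in \<open>q(f)\<close>: it gives \<open>q(f) = q(g) / (1 + b m(g))\<close>.
  After multiplication by \<open>1 + b m(g) > 0\<close> the components of \<open>f\<close> become polynomials with
  nonnegative coefficients in \<open>b\<close> and the components of \<open>g\<close> (lemma
  \<open>nonneg_of_implicit_collision\<close>), which proves (P2).

  The same direction is an eigenvector of \<open>Q'(g)\<close> with eigenvalue \<open>-m(g)\<close>, so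
  \<open>Q'(g) Q(f) = -m(g) Q(f)\<close> (lemma \<open>dir_deriv_collision_collision\<close>).  Hence (P3) is (P2) with
  \<open>b m(g)\<close> in place of \<open>b\<close>; since this factor depends on the spatial point, the implicit step is
  treated with a coefficient that is a function of \<open>x\<close>.  For (P4) the factor is \<open>b m(f)\<close>, whose
  sign is not known beforehand, but conservation of mass yields \<open>m(f) = m(h) \<ge> 0\<close>.

  Property (P1) holds because the CFL constant is an admissible step, not merely a supremum of
  admissible steps.
\<close>

definition mass :: "real ^ 3 \<Rightarrow> real" where
  "mass v = v $ 1 + 2 * v $ 2 + v $ 3"

lemma mass_nonneg: "nonneg f \<Longrightarrow> 0 \<le> mass (f x)"
  by (simp add: nonneg_def mass_def)

lemma mass_diff_scaleR: "mass (u - c *\<^sub>R v) = mass u - c * mass v"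
  by (simp add: mass_def algebra_simps)

lemma mass_collision: "mass (collision f x) = 0"
  by (simp add: mass_def collision_def)

text \<open>
  Since \<open>Q\<close> is quadratic, its difference quotient at \<open>g\<close> is affine in \<open>\<delta>\<close>, with slope \<open>Q(f)\<close>.
\<close>

lemma dir_deriv_collision:
  "dir_deriv collision g f x =
     (2 * g x $ 2 * f x $ 2 - g x $ 1 * f x $ 3 - g x $ 3 * f x $ 1) *\<^sub>R vector [1, -1, 1]"
  (is "_ = ?L")
proof -
  let ?quot = "\<lambda>\<delta>::real. (collision (\<lambda>y. g y + \<delta> *\<^sub>R f y) x - collision g x) /\<^sub>R \<delta>"
  have quot: "?quot \<delta> = ?L + \<delta> *\<^sub>R collision f x" if "\<delta> \<noteq> 0" for \<delta>
    using that
    by (simp add: vec_eq_iff forall_3 collision_def field_simps power2_eq_square)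
  have "((\<lambda>\<delta>. ?L + \<delta> *\<^sub>R collision f x) \<longlongrightarrow> ?L + 0 *\<^sub>R collision f x) (at 0)"
    by (intro tendsto_intros)
  then have "((\<lambda>\<delta>. ?L + \<delta> *\<^sub>R collision f x) \<longlongrightarrow> ?L) (at 0)"
    by simp
  moreover have "\<forall>\<^sub>F \<delta> in at 0. ?L + \<delta> *\<^sub>R collision f x = ?quot \<delta>"
    unfolding eventually_at_filter using quot by (intro always_eventually) simp
  ultimately have "(?quot \<longlongrightarrow> ?L) (at 0)"
    by (rule Lim_transform_eventually)
  then show ?thesis
    unfolding dir_deriv_def by (intro tendsto_Lim) simp_all
qed

lemma dir_deriv_collision_collision:
  "dir_deriv collision g (collision f) x = - mass (g x) *\<^sub>R collision f x"
  unfolding dir_deriv_collision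
  by (simp add: vec_eq_iff forall_3 collision_def mass_def algebra_simps)

text \<open>
  The scalar core of (P2): \<open>q\<close> is the collision rate of the unknown state
  \<open>(u + c q, v - c q, w + c q)\<close>.
\<close>

lemma implicit_collision_rate_bounds:
  fixes u v w c q :: real
  assumes uvw: "0 \<le> u" "0 \<le> v" "0 \<le> w" and c: "0 \<le> c"
    and q: "q = (v - c * q)\<^sup>2 - (u + c * q) * (w + c * q)"
  shows "0 \<le> u + c * q" "0 \<le> v - c * q" "0 \<le> w + c * q"
proof -
  define d where "d = 1 + c * (u + 2 * v + w)"
  have d: "0 < d"
    unfolding d_def using uvw c by (simp add: add_pos_nonneg)
  have dq: "d * q = v\<^sup>2 - u * w"
    using q unfolding d_def by (simp add: algebra_simps power2_eq_square)
  have "d * (u + c * q) = d * u + c * (d * q)"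
    by (simp add: algebra_simps)
  also have "\<dots> = u + c * (u\<^sup>2 + 2 * u * v + v\<^sup>2)"
    unfolding dq by (simp add: d_def algebra_simps power2_eq_square)
  finally have "0 \<le> d * (u + c * q)"
    using uvw c by simp
  then show "0 \<le> u + c * q"
    using d by (simp add: zero_le_mult_iff)
  have "d * (v - c * q) = d * v - c * (d * q)"
    by (simp add: algebra_simps)
  also have "\<dots> = v + c * (u * v + v\<^sup>2 + v * w + u * w)"
    unfolding dq by (simp add: d_def algebra_simps power2_eq_square)
  finally have "0 \<le> d * (v - c * q)"
    using uvw c by simp
  then show "0 \<le> v - c * q"
    using d by (simp add: zero_le_mult_iff)
  have "d * (w + c * q) = d * w + c * (d * q)"
    by (simp add: algebra_simps)
  also have "\<dots> = w + c * (w\<^sup>2 + 2 * v * w + v\<^sup>2)"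
    unfolding dq by (simp add: d_def algebra_simps power2_eq_square)
  finally have "0 \<le> d * (w + c * q)"
    using uvw c by simp
  then show "0 \<le> w + c * q"
    using d by (simp add: zero_le_mult_iff)
qed

text \<open>
  The coefficient may vary in space, because (P3) and (P4) lead to coefficients that are
  proportional to the local mass.
\<close>

lemma nonneg_of_implicit_collision:
  assumes g: "nonneg g" and c: "\<And>x. 0 \<le> c x"
    and eq: "\<And>x. f x - c x *\<^sub>R collision f x = g x"
  shows "nonneg f"
proof -
  have "0 \<le> f x $ i" for x i
  proof -
    define q where "q = (f x $ 2)\<^sup>2 - f x $ 1 * f x $ 3"
    have "f x = g x + c x *\<^sub>R collision f x"
      using eq[of x] by (simp add: algebra_simps)
    then have f: "f x $ 1 = g x $ 1 + c x * q" "f x $ 2 = g x $ 2 - c x * q"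
        "f x $ 3 = g x $ 3 + c x * q"
      by (simp_all add: vec_eq_iff forall_3 collision_def q_def algebra_simps)
    have "0 \<le> g x $ j" for j
      using g by (simp add: nonneg_def)
    moreover have "q = (g x $ 2 - c x * q)\<^sup>2 - (g x $ 1 + c x * q) * (g x $ 3 + c x * q)"
      using q_def unfolding f .
    ultimately have "0 \<le> g x $ 1 + c x * q" "0 \<le> g x $ 2 - c x * q" "0 \<le> g x $ 3 + c x * q"
      using implicit_collision_rate_bounds[of "g x $ 1" "g x $ 2" "g x $ 3" "c x" q] c[of x]
      by blast+
    then have "\<forall>i. 0 \<le> f x $ i"
      unfolding forall_3 f by simp
    then show ?thesis ..
  qed
  then show ?thesis
    unfolding nonneg_def by blast
qed

lemma fe_positive_cfl:
  assumes "positivity_preserving T"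
  shows "fe_positive T (cfl T)"
proof -
  obtain \<tau> where "fe_positive T \<tau>" "\<And>\<sigma>. fe_positive T \<sigma> \<Longrightarrow> \<sigma> \<le> \<tau>"
    using assms unfolding positivity_preserving_def by blast
  then show ?thesis
    unfolding cfl_def by (rule GreatestI2_order)
qed

theorem mainTheorem7:
  fixes Dp Dm :: "('x \<Rightarrow> real) \<Rightarrow> 'x \<Rightarrow> real"
  assumes "positivity_preserving (transport Dp Dm)"
  shows
    "(\<forall>(f :: 'x state) (a :: real) (\<Delta>t :: real).
        nonneg f \<longrightarrow> 0 \<le> a * \<Delta>t \<longrightarrow> a * \<Delta>t \<le> cfl (transport Dp Dm) \<longrightarrow>
        nonneg (\<lambda>x. f x + (a * \<Delta>t) *\<^sub>R transport Dp Dm f x)) \<and>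
     (\<forall>(f :: 'x state) (g :: 'x state) (b :: real).
        nonneg g \<longrightarrow> 0 \<le> b \<longrightarrow>
        (\<forall>x. f x - b *\<^sub>R collision f x = g x) \<longrightarrow>
        nonneg f) \<and>
     (\<forall>(f :: 'x state) (g :: 'x state) (h :: 'x state) (b :: real).
        nonneg g \<longrightarrow> nonneg h \<longrightarrow> 0 \<le> b \<longrightarrow>
        (\<forall>x. f x + b *\<^sub>R dir_deriv collision g (collision f) x = h x) \<longrightarrow>
        nonneg f) \<and>
     (\<forall>(f :: 'x state) (h :: 'x state) (b :: real).
        nonneg h \<longrightarrow> 0 \<le> b \<longrightarrow>
        (\<forall>x. f x + b *\<^sub>R dir_deriv collision f (collision f) x = h x) \<longrightarrow>
        nonneg f)"
proof (intro conjI allI impI)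
  fix f :: "'x state" and a \<Delta>t :: real
  assume "nonneg f" "0 \<le> a * \<Delta>t" "a * \<Delta>t \<le> cfl (transport Dp Dm)"
  then show "nonneg (\<lambda>x. f x + (a * \<Delta>t) *\<^sub>R transport Dp Dm f x)"
    using fe_positive_cfl[OF assms] unfolding fe_positive_def by blast
next
  fix f g :: "'x state" and b :: real
  assume "nonneg g" "0 \<le> b" "\<forall>x. f x - b *\<^sub>R collision f x = g x"
  then show "nonneg f"
    using nonneg_of_implicit_collision[of g "\<lambda>_. b" f] by blast
next
  fix f g h :: "'x state" and b :: real
  assume g: "nonneg g" and h: "nonneg h" and b: "0 \<le> b"
    and eq: "\<forall>x. f x + b *\<^sub>R dir_deriv collision g (collision f) x = h x"
  show "nonneg f"
  proof (rule nonneg_of_implicit_collision[OF h])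
    show "0 \<le> b * mass (g x)" for x
      using b mass_nonneg[OF g] by simp
    show "f x - (b * mass (g x)) *\<^sub>R collision f x = h x" for x
      using eq by (simp add: dir_deriv_collision_collision)
  qed
next
  fix f h :: "'x state" and b :: real
  assume h: "nonneg h" and b: "0 \<le> b"
    and eq: "\<forall>x. f x + b *\<^sub>R dir_deriv collision f (collision f) x = h x"
  have step: "f x - (b * mass (f x)) *\<^sub>R collision f x = h x" for x
    using eq by (simp add: dir_deriv_collision_collision)
  have "mass (h x) = mass (f x)" for x
    unfolding step[symmetric] mass_diff_scaleR by (simp add: mass_collision)
  then have "0 \<le> mass (f x)" for x
    using mass_nonneg[OF h, of x] by simp
  with b show "nonneg f"
    by (intro nonneg_of_implicit_collision[OF h _ step]) simp
qed

end
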